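(* Let $\mathbf Z=(\mathbf Y,\mathbf X)$ be an ergodic unreliable Jackson network process with stationary distribution $\tilde\pi=\hat\pi\otimes\pi$, and let $f,g\in L^2(\tilde{\mathbb E},\tilde\pi)$ be real functions. Then $$\langle f,Q^{\mathbf Z}g\rangle_{\tilde\pi}=\sum_{n\in\mathbb N^J}\pi(n)\Big\{\sum_{D\subseteq\tilde J}\hat\pi(D)f(D,n)\big(Q^{\mathbf Y}g(\cdot,n)\big)(D)\Big\}$$ $$+\sum_{D\subseteq\tilde J}\hat\pi(D)\sum_{n_D\in\mathbb N^{|D|}}\pi_D(n_D)\Big\{\sum_{n_{\tilde J\setminus D}\in\mathbb N^{J-|D|}}\pi_{\tilde J\setminus D}(n_{\tilde J\setminus D})\,f\big(D,(n_D,n_{\tilde J\setminus D})\big)\Big(Q^{\mathbf X_{\tilde J\setminus D}}g\big(D,(n_D,(\cdot)_{\tilde J\setminus D})\big)\Big)(n_{\tilde J\setminus D})\Big\}.$$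
   Context: Notation: $\mathbb N=\{0,1,2,\dots\}$, $\tilde J=\{1,\dots,J\}$, $\tilde J_0=\{0,1,\dots,J\}$; $\subset$ denotes strict inclusion; $e_j$ is the $j$-th standard base vector of $\mathbb N^J$ ($1\le j\le J$) and $e_0=0$. For $n\in\mathbb N^J$ and $D\subseteq\tilde J$, $n_D=(n_j:j\in D)$ and $n$ is identified with $(n_D,n_{\tilde J\setminus D})$. $\langle f,g\rangle_{\nu}=\int fg\,d\nu$. Network data: an arrival intensity $\lambda>0$; an irreducible stochastic routing matrix $R=[r_{ij}]_{i,j\in\tilde J_0}$ ($r_{00}\ge 0$ allowed; node $0$ is source and sink); service rates $\mu_j(k)>0$ for $k\ge1$, $\mu_j(0)=0$, with $\sup_{j,k}\mu_j(k)<\infty$. The traffic equations $\eta_j=\lambda r_{0j}+\sum_{i=1}^J\eta_ir_{ij}$, $j\in\tilde J$, have a unique solution $(\eta_j)_{j\in\tilde J}$. The network (without breakdowns) is assumed ergodic, i.e. $C_j:=\sum_{m\ge0}\prod_{k=1}^{m}\eta_j/\mu_j(k)<\infty$ for all $j$, and $\pi(n)=\prod_{j=1}^J C_j^{-1}\prod_{k=1}^{n_j}\frac{\eta_j}{\mu_j(k)}$ on $\mathbb N^J$. For $K\subseteq\tilde J$: $\pi_K(n_K)=\prod_{j\in K}C_j^{-1}\prod_{k=1}^{n_j}\frac{\eta_j}{\mu_j(k)}$. Breakdown and repair: functions $A,B:2^{\tilde J}\to[0,\infty)$ with $A(\emptyset)=B(\emptyset)=1$, $A(I)/A(D)<\infty$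 for all $D\subset I\subseteq\tilde J$ and $B(D)/B(H)<\infty$ for all $H\subset D\subseteq\tilde J$ (conventions $0/0=0$, $1/0=\infty$). $\mathbf Y$ is the Markov process on $2^{\tilde J}$ (its state is the set of broken down nodes) with rates $q^{\mathbf Y}(D,I)=A(I)/A(D)$ for $D\subset I$, $q^{\mathbf Y}(D,H)=B(D)/B(H)$ for $H\subset D$, other off-diagonal rates zero, and generator $Q^{\mathbf Y}$ given by $(Q^{\mathbf Y}h)(D)=\sum_{H\subset D}q^{\mathbf Y}(D,H)(h(H)-h(D))+\sum_{I\supset D}q^{\mathbf Y}(D,I)(h(I)-h(D))$. It is reversible with respect to the probability $\hat\pi(D)=\hat C^{-1}A(D)/B(D)$. Rerouting assumption: for each $D\subseteq\tilde J$ there is a stochastic matrix $R^D=[r^D_{ij}]_{i,j\in\tilde J_0\setminus D}$, $R^\emptyset=R$, such that $\eta_j=\lambda r^D_{0j}+\sum_{i\in\tilde J\setminus D}\eta_ir^D_{ij}$ for all $j\in\tilde J\setminus D$ (same $\eta$ for every $D$). Unreliable Jackson network process $\mathbf Z=(\mathbf Y,\mathbf X)$: the Markov process on $\tilde{\mathbb E}=2^{\tilde J}\times\mathbb N^J$ with generator $(Q^{\mathbf Z}f)(D,n)=\sum_{j\in\tilde J\setminus D}\lambda r^D_{0j}(f(D,n+e_j)-f(D,n))+\sum_{j\in\tilde J\setminus D}\mu_j(n_j)r^D_{j0}(f(D,n-e_j)-f(D,n))+\sum_{j\in\tilde J\setminus D}\mu_j(n_j)\sum_{i\in\tilde J\setminus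 D}r^D_{ji}(f(D,n-e_j+e_i)-f(D,n))+(Q^{\mathbf Y}f(\cdot,n))(D)$. Terms with factor $\mu_j(0)$ are zero. If $\mathbf Z$ is ergodic, its unique stationary distribution is known to be $\tilde\pi(D,n)=\hat\pi(D)\pi(n)$. Synthetic subnetworks: for $D\subseteq\tilde J$, $Q^{\mathbf X_{\tilde J\setminus D}}$ is the generator, acting on functions $h$ of $m=(m_j:j\in\tilde J\setminus D)\in\mathbb N^{J-|D|}$, of the Jackson network on node set $\tilde J\setminus D$ with arrival rate $\lambda$, service rates $\mu_j$ and routing matrix $R^D$: $(Q^{\mathbf X_{\tilde J\setminus D}}h)(m)=\sum_{j\in\tilde J\setminus D}\lambda r^D_{0j}(h(m+e_j)-h(m))+\sum_{j\in\tilde J\setminus D}\mu_j(m_j)r^D_{j0}(h(m-e_j)-h(m))+\sum_{j,i\in\tilde J\setminus D}\mu_j(m_j)r^D_{ji}(h(m-e_j+e_i)-h(m))$. *)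

theory Defs
  imports "HOL-Probability.Probability"
begin

section \<open>Markov processes in continuous time on a discrete state space\<close>

text \<open>A time-homogeneous Markov process with state space \<open>S\<close> is given by its transition
  probabilities: \<open>P t x\<close> is the law at time \<open>t\<close> of the process started in \<open>x\<close>.\<close>

definition markov_process :: "'s set \<Rightarrow> (real \<Rightarrow> 's \<Rightarrow> 's pmf) \<Rightarrow> bool" where
  "markov_process S P \<longleftrightarrow>
     (\<forall>t\<ge>0. \<forall>x\<in>S. set_pmf (P t x) \<subseteq> S) \<and>
     (\<forall>x\<in>S. P 0 x = return_pmf x) \<and>
     (\<forall>s\<ge>0. \<forall>t\<ge>0. \<forall>x\<in>S. P (s + t) x = bind_pmf (P s x) (P t))"

definition has_generator ::
  "'s set \<Rightarrow> (real \<Rightarrow> 's \<Rightarrow> 's pmf) \<Rightarrow> (('s \<Rightarrow> real) \<Rightarrow> 's \<Rightarrow> real) \<Rightarrow> bool" where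
  "has_generator S P Q \<longleftrightarrow>
     (\<forall>f. bounded (f ` S) \<longrightarrow>
       (\<forall>x\<in>S. ((\<lambda>t. (measure_pmf.expectation (P t x) f - f x) / t) \<longlongrightarrow> Q f x) (at_right 0)))"

text \<open>Convergence to one limiting probability from every initial state. For an irreducible
  process this is positive recurrence; transient states are allowed as well, since sets of
  nodes \<open>D\<close> with \<open>A(D) = 0\<close> cannot be reached by the breakdown process.\<close>

definition ergodic :: "'s set \<Rightarrow> (real \<Rightarrow> 's \<Rightarrow> 's pmf) \<Rightarrow> bool" where
  "ergodic S P \<longleftrightarrow>
     (\<exists>p. set_pmf p \<subseteq> S \<and>
       (\<forall>x\<in>S. \<forall>y\<in>S. ((\<lambda>t. pmf (P t x) y) \<longlongrightarrow> pmf p y) at_top))"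

section \<open>Square integrable functions\<close>

definition L2 :: "'a measure \<Rightarrow> ('a \<Rightarrow> real) set" where
  "L2 M = {f \<in> borel_measurable M. integrable M (\<lambda>x. (f x)\<^sup>2)}"

definition L2_inner :: "'a measure \<Rightarrow> ('a \<Rightarrow> real) \<Rightarrow> ('a \<Rightarrow> real) \<Rightarrow> real" where
  "L2_inner M f g = (\<integral>x. f x * g x \<partial>M)"

section \<open>Stochastic matrices indexed by a finite set of nodes\<close>

definition stochastic_on :: "nat set \<Rightarrow> (nat \<Rightarrow> nat \<Rightarrow> real) \<Rightarrow> bool" where
  "stochastic_on S r \<longleftrightarrow> (\<forall>i\<in>S. (\<forall>j\<in>S. 0 \<le> r i j) \<and> (\<Sum>j\<in>S. r i j) = 1)"

definition irreducible_on :: "nat set \<Rightarrow> (nat \<Rightarrow> nat \<Rightarrow> real) \<Rightarrow> bool" where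
  "irreducible_on S r \<longleftrightarrow>
     (\<forall>i\<in>S. \<forall>j\<in>S. (i, j) \<in> {(a, b). a \<in> S \<and> b \<in> S \<and> r a b > 0}\<^sup>+)"

section \<open>Unreliable Jackson networks\<close>

text \<open>\<open>serv N j k\<close> is the service rate \<open>\<mu>\<^sub>j(k)\<close>, \<open>brk N\<close> and \<open>rep N\<close> are the functions
  \<open>A\<close> and \<open>B\<close>, and \<open>reroute N D\<close> is \<open>R\<^sup>D\<close>, of which only the entries with indices in
  \<open>nodes0 N - D\<close> matter.\<close>

record network =
  num_nodes :: nat
  arrival :: real
  routing :: "nat \<Rightarrow> nat \<Rightarrow> real"
  serv :: "nat \<Rightarrow> nat \<Rightarrow> real"
  eta :: "nat \<Rightarrow> real"
  brk :: "nat set \<Rightarrow> real"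
  rep :: "nat set \<Rightarrow> real"
  reroute :: "nat set \<Rightarrow> nat \<Rightarrow> nat \<Rightarrow> real"

definition nodes :: "network \<Rightarrow> nat set" where
  "nodes N = {1..num_nodes N}"

definition nodes0 :: "network \<Rightarrow> nat set" where
  "nodes0 N = {0..num_nodes N}"

definition traffic_equations ::
  "nat set \<Rightarrow> real \<Rightarrow> (nat \<Rightarrow> nat \<Rightarrow> real) \<Rightarrow> (nat \<Rightarrow> real) \<Rightarrow> bool" where
  "traffic_equations K l r \<eta> \<longleftrightarrow> (\<forall>j\<in>K. \<eta> j = l * r 0 j + (\<Sum>i\<in>K. \<eta> i * r i j))"

text \<open>The assumptions \<open>brk_finite\<close> and \<open>rep_finite\<close> say that the ratios \<open>A(I)/A(D)\<close> and
  \<open>B(D)/B(H)\<close> are finite under the conventions \<open>0/0 = 0\<close> and \<open>1/0 = \<infinity>\<close>.\<close>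

locale unreliable_jackson_network =
  fixes N :: network
  assumes arrival_pos: "arrival N > 0"
    and routing_stochastic: "stochastic_on (nodes0 N) (routing N)"
    and routing_irreducible: "irreducible_on (nodes0 N) (routing N)"
    and serv_pos: "\<And>j k. j \<in> nodes N \<Longrightarrow> k \<ge> 1 \<Longrightarrow> serv N j k > 0"
    and serv_0: "\<And>j. j \<in> nodes N \<Longrightarrow> serv N j 0 = 0"
    and serv_bounded: "bdd_above ((\<lambda>(j, k). serv N j k) ` (nodes N \<times> UNIV))"
    and traffic: "traffic_equations (nodes N) (arrival N) (routing N) (eta N)"
    and jackson_ergodic:
      "\<And>j. j \<in> nodes N \<Longrightarrow> summable (\<lambda>m. \<Prod>k=1..m. eta N j / serv N j k)"
    and brk_nonneg: "\<And>D. D \<subseteq> nodes N \<Longrightarrow> brk N D \<ge> 0"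
    and rep_nonneg: "\<And>D. D \<subseteq> nodes N \<Longrightarrow> rep N D \<ge> 0"
    and brk_empty: "brk N {} = 1"
    and rep_empty: "rep N {} = 1"
    and brk_finite: "\<And>D I. D \<subset> I \<Longrightarrow> I \<subseteq> nodes N \<Longrightarrow> brk N D = 0 \<Longrightarrow> brk N I = 0"
    and rep_finite: "\<And>H D. H \<subset> D \<Longrightarrow> D \<subseteq> nodes N \<Longrightarrow> rep N H = 0 \<Longrightarrow> rep N D = 0"
    and reroute_stochastic:
      "\<And>D. D \<subseteq> nodes N \<Longrightarrow> stochastic_on (nodes0 N - D) (reroute N D)"
    and reroute_empty:
      "\<And>i j. i \<in> nodes0 N \<Longrightarrow> j \<in> nodes0 N \<Longrightarrow> reroute N {} i j = routing N i j"
    and reroute_traffic: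
      "\<And>D. D \<subseteq> nodes N \<Longrightarrow> traffic_equations (nodes N - D) (arrival N) (reroute N D) (eta N)"

section \<open>State space and stationary distributions\<close>

text \<open>\<open>vecs K\<close> stands for the vectors \<open>(n\<^sub>j : j \<in> K)\<close> of natural numbers. For \<open>u \<in> vecs D\<close> and
  \<open>v \<in> vecs (nodes N - D)\<close>, the vector \<open>(u, v)\<close> in \<open>vecs (nodes N)\<close> is
  \<open>merge D (nodes N - D) (u, v)\<close>.\<close>

definition vecs :: "nat set \<Rightarrow> (nat \<Rightarrow> nat) set" where
  "vecs K = (K \<rightarrow>\<^sub>E UNIV)"

definition states :: "network \<Rightarrow> (nat set \<times> (nat \<Rightarrow> nat)) set" where
  "states N = Pow (nodes N) \<times> vecs (nodes N)"

definition norm_const :: "network \<Rightarrow> nat \<Rightarrow> real" where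
  "norm_const N j = (\<Sum>m. \<Prod>k=1..m. eta N j / serv N j k)"

definition queue_dist :: "network \<Rightarrow> nat set \<Rightarrow> (nat \<Rightarrow> nat) \<Rightarrow> real" where
  "queue_dist N K n = (\<Prod>j\<in>K. inverse (norm_const N j) * (\<Prod>k=1..n j. eta N j / serv N j k))"

definition breakdown_dist :: "network \<Rightarrow> nat set \<Rightarrow> real" where
  "breakdown_dist N D = inverse (\<Sum>I\<in>Pow (nodes N). brk N I / rep N I) * (brk N D / rep N D)"

definition stationary_measure :: "network \<Rightarrow> (nat set \<times> (nat \<Rightarrow> nat)) measure" where
  "stationary_measure N =
     point_measure (states N)
       (\<lambda>(D, n). ennreal (breakdown_dist N D * queue_dist N (nodes N) n))"

section \<open>Generators\<close>

definition QY :: "network \<Rightarrow> (nat set \<Rightarrow> real) \<Rightarrow> nat set \<Rightarrow> real" where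
  "QY N h D =
     (\<Sum>H | H \<subset> D. rep N D / rep N H * (h H - h D)) +
     (\<Sum>I | D \<subset> I \<and> I \<subseteq> nodes N. brk N I / brk N D * (h I - h D))"

text \<open>\<open>inc j n\<close> is \<open>n + e\<^sub>j\<close> and \<open>dec j n\<close> is \<open>n - e\<^sub>j\<close>. The latter truncates if \<open>n j = 0\<close>, but
  below it only occurs with the factor \<open>serv N j (n j)\<close>, which is then zero.\<close>

definition inc :: "nat \<Rightarrow> (nat \<Rightarrow> nat) \<Rightarrow> nat \<Rightarrow> nat" where
  "inc j n = n(j := n j + 1)"

definition dec :: "nat \<Rightarrow> (nat \<Rightarrow> nat) \<Rightarrow> nat \<Rightarrow> nat" where
  "dec j n = n(j := n j - 1)"

definition QZ ::
  "network \<Rightarrow> (nat set \<times> (nat \<Rightarrow> nat) \<Rightarrow> real) \<Rightarrow> nat set \<times> (nat \<Rightarrow> nat) \<Rightarrow> real" where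
  "QZ N f = (\<lambda>(D, n).
     (\<Sum>j\<in>nodes N - D. arrival N * reroute N D 0 j * (f (D, inc j n) - f (D, n))) +
     (\<Sum>j\<in>nodes N - D. serv N j (n j) * reroute N D j 0 * (f (D, dec j n) - f (D, n))) +
     (\<Sum>j\<in>nodes N - D. serv N j (n j) *
        (\<Sum>i\<in>nodes N - D. reroute N D j i * (f (D, inc i (dec j n)) - f (D, n)))) +
     QY N (\<lambda>I. f (I, n)) D)"

text \<open>The generator of the Jackson network with node set \<open>nodes N - D\<close> and routing \<open>R\<^sup>D\<close>.\<close>

definition QX :: "network \<Rightarrow> nat set \<Rightarrow> ((nat \<Rightarrow> nat) \<Rightarrow> real) \<Rightarrow> (nat \<Rightarrow> nat) \<Rightarrow> real" where
  "QX N D h m =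
     (\<Sum>j\<in>nodes N - D. arrival N * reroute N D 0 j * (h (inc j m) - h m)) +
     (\<Sum>j\<in>nodes N - D. serv N j (m j) * reroute N D j 0 * (h (dec j m) - h m)) +
     (\<Sum>j\<in>nodes N - D. \<Sum>i\<in>nodes N - D.
        serv N j (m j) * reroute N D j i * (h (inc i (dec j m)) - h m))"

end

theory Submission
  imports Defs
begin

text \<open>Write \<open>\<pi>\<close> for \<open>queue_dist N (nodes N)\<close> and \<open>\<pi>'\<close> for \<open>breakdown_dist N\<close>. On functions of full
  vectors, the generator of the network outside \<open>D\<close> is literally the network part of \<open>QZ N\<close> in the
  breakdown state \<open>D\<close> (\<open>QZ_eq_QX_plus_QY\<close>), since both move only the coordinates outside \<open>D\<close>. As \<open>\<pi>\<close>
  is a product over the nodes, a sum over \<open>n\<close> is an iterated sum over \<open>n\<^sub>D\<close> and the remaining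
  coordinates (\<open>infsum_vecs_split\<close>). The identity is therefore a rearrangement of a multiple series,
  and everything rests on its absolute convergence.

  For the network part, let \<open>T\<close> be one of the moves \<open>n \<mapsto> n + e\<^sub>j\<close>, \<open>n - e\<^sub>j\<close>, \<open>n - e\<^sub>j + e\<^sub>i\<close>. It is
  injective where its rate is nonzero, and the product form with \<open>\<eta> > 0\<close> and bounded \<open>\<mu>\<close> gives
  \<open>\<pi>(n) rate(n) \<le> K \<pi>(T n)\<close>. Together with \<open>\<bar>f g\<bar> \<le> f\<^sup>2 + g\<^sup>2\<close> this bounds
  \<open>\<Sum> \<pi>(n) rate(n) \<bar>f(n) g(T n)\<bar>\<close> by the two \<open>L\<^sup>2\<close> norms (\<open>summable_on_weighted_transition\<close>). Positivity
  of \<open>\<eta>\<close> (\<open>eta_pos\<close>) comes from the irreducibility of the routing: the traffic equations make \<open>\<eta>\<close>, with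
  \<open>\<lambda>\<close> as its entry at node \<open>0\<close>, an invariant vector of the routing matrix.

  For the breakdown part, the \<open>L\<^sup>2\<close> hypothesis controls \<open>g(I, \<cdot>)\<close> only if \<open>\<pi>'(I) > 0\<close>, so one has to
  know that a set \<open>D\<close> with \<open>\<pi>'(D) > 0\<close> has positive rates only to sets \<open>I\<close> with \<open>\<pi>'(I) > 0\<close>. This
  could fail only if \<open>B(I) = 0\<close> for some \<open>I\<close>, and ergodicity excludes that (\<open>rep_pos_if_ergodic\<close>): the
  nodes in \<open>I\<close> would never be repaired, so the queue length at a node \<open>i \<in> I\<close> would stay constant
  forever, and starts with different queue lengths at \<open>i\<close> could not share a limiting distribution.
  To turn this into a proof one must deduce from the generator that a set which it does not leave
  is not left by the transition probabilities either (\<open>closed_set_absorbing\<close>).\<close>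

section \<open>Closed sets of Markov processes with bounded holding rates\<close>

lemma measure_bind_pmf_eq:
  "measure_pmf.prob (bind_pmf p K) C = measure_pmf.expectation p (\<lambda>y. measure_pmf.prob (K y) C)"
proof -
  have "ennreal (measure_pmf.prob (bind_pmf p K) C) = (\<integral>\<^sup>+y. ennreal (measure_pmf.prob (K y) C) \<partial>p)"
    by (simp flip: measure_pmf.emeasure_eq_measure)
  also have "\<dots> = ennreal (measure_pmf.expectation p (\<lambda>y. measure_pmf.prob (K y) C))"
    by (intro nn_integral_eq_integral measure_pmf.integrable_const_bound[where B=1]) auto
  finally show ?thesis
    by (simp add: integral_nonneg_AE)
qed

lemma pmf_mult_le_expectation:
  assumes "\<And>y. 0 \<le> \<phi> y" "\<And>y. \<phi> y \<le> (b::real)"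
  shows "pmf p x * \<phi> x \<le> measure_pmf.expectation p \<phi>"
proof -
  have b: "0 \<le> b" using assms[of x] by linarith
  have "pmf p x * \<phi> x = measure_pmf.expectation p (\<lambda>y. indicator {x} y * \<phi> x)"
    by (simp add: measure_pmf_single)
  also have "\<dots> \<le> measure_pmf.expectation p \<phi>"
    by (intro integral_mono measure_pmf.integrable_const_bound[where B=b])
       (auto simp: assms b indicator_def)
  finally show ?thesis .
qed

text \<open>By the Markov property the holding probability \<open>p(s)\<close> satisfies \<open>p(s + t) \<ge> p(s) p(t)\<close>. The
  generator controls it only as \<open>s \<rightarrow> 0\<close>, but \<open>p(s) \<ge> p(s/n)\<^sup>n \<ge> (1 - \<Lambda> s/n)\<^sup>n \<ge> 1 - \<Lambda> s\<close> carries the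
  bound to every \<open>s\<close>. The point is that the result is uniform in \<open>x\<close> when \<open>\<Lambda>\<close> is.\<close>

lemma holding_probability_ge:
  assumes mp: "markov_process S P" and gen: "has_generator S P Q" and x: "x \<in> S"
    and rate: "Q (indicator {x}) x > - \<Lambda>" and s: "s \<ge> 0"
  shows "pmf (P s x) x \<ge> 1 - \<Lambda> * s"
proof (cases "s = 0")
  case True
  then show ?thesis using mp x by (auto simp: markov_process_def)
next
  case False
  with s have s: "s > 0" by simp
  have P0: "P 0 x = return_pmf x" using mp x by (auto simp: markov_process_def)
  have super: "pmf (P (t + u) x) x \<ge> pmf (P t x) x * pmf (P u x) x" if "t \<ge> 0" "u \<ge> 0" for t u
  proof -
    have "P (t + u) x = bind_pmf (P t x) (P u)"
      using mp x that by (auto simp: markov_process_def)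
    then have "pmf (P (t + u) x) x = measure_pmf.expectation (P t x) (\<lambda>y. pmf (P u y) x)"
      by (simp add: pmf_bind)
    then show ?thesis
      using pmf_mult_le_expectation[of "\<lambda>y. pmf (P u y) x" 1 "P t x" x] by (simp add: pmf_le_1)
  qed
  have power: "pmf (P (real n * t) x) x \<ge> pmf (P t x) x ^ n" if "t \<ge> 0" for n t
  proof (induction n)
    case (Suc n)
    have "pmf (P t x) x ^ Suc n \<le> pmf (P t x) x * pmf (P (real n * t) x) x"
      using Suc by (simp add: mult_left_mono)
    also have "\<dots> \<le> pmf (P (t + real n * t) x) x"
      using super[of t "real n * t"] that by simp
    finally show ?case by (simp add: algebra_simps)
  qed (simp add: P0)
  have "((\<lambda>t. (pmf (P t x) x - 1) / t) \<longlongrightarrow> Q (indicator {x}) x) (at_right 0)"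
  proof -
    have "bounded ((indicator {x} :: _ \<Rightarrow> real) ` S)"
      by (rule boundedI[of _ 1]) (auto simp: indicator_def)
    then show ?thesis
      using gen x unfolding has_generator_def by (fastforce simp: measure_pmf_single)
  qed
  then have "eventually (\<lambda>t. (pmf (P t x) x - 1) / t > - \<Lambda>) (at_right 0)"
    using rate by (rule order_tendstoD)
  then obtain \<delta> where \<delta>: "\<delta> > 0" "\<And>t. 0 < t \<Longrightarrow> t < \<delta> \<Longrightarrow> (pmf (P t x) x - 1) / t > - \<Lambda>"
    unfolding eventually_at_right_field by auto
  \<comment> \<open>the first bound makes \<open>s / n < \<delta>\<close>, the second makes Bernoulli's inequality applicable\<close>
  obtain n where n: "real n > max (s / \<delta>) (\<Lambda> * s)"
    using reals_Archimedean2 by blast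
  have npos: "real n > 0" using n s \<delta>(1) by (smt (verit) divide_pos_pos)
  define t where "t = s / real n"
  have t: "0 < t" "t < \<delta>" "real n * t = s"
    using n npos s \<delta>(1) by (auto simp: t_def field_simps)
  have step: "pmf (P t x) x \<ge> 1 - \<Lambda> * t"
    using \<delta>(2)[OF t(1,2)] t(1) by (simp add: field_simps)
  have small: "- (\<Lambda> * t) \<ge> -1"
    using n npos by (simp add: t_def field_simps)
  have "1 - \<Lambda> * s = 1 + real n * (- (\<Lambda> * t))" using t(3) by (simp add: algebra_simps)
  also have "\<dots> \<le> (1 + (- (\<Lambda> * t))) ^ n" by (rule Bernoulli_inequality[OF small])
  also have "\<dots> \<le> pmf (P t x) x ^ n" using step small by (intro power_mono) auto
  also have "\<dots> \<le> pmf (P (real n * t) x) x" using power t(1) by simp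
  finally show ?thesis using t(3) by simp
qed

text \<open>A function whose right derivative is nonnegative in the weak sense of \<open>right\<close> (along some small
  increments, up to \<open>\<epsilon>\<close>) does not decrease; \<open>left\<close> replaces continuity, as it prevents downward
  jumps. The set of times up to \<open>T\<close> at which the bound holds has a largest element, which by
  \<open>right\<close> can only be \<open>T\<close>.\<close>

lemma ge_if_right_increments_ge:
  fixes h :: "real \<Rightarrow> real"
  assumes left: "\<And>t s. 0 \<le> t \<Longrightarrow> 0 \<le> s \<Longrightarrow> h (t + s) \<ge> h t - L * s"
    and right: "\<And>t \<delta>. 0 \<le> t \<Longrightarrow> 0 < \<delta> \<Longrightarrow> \<exists>s. 0 < s \<and> s < \<delta> \<and> h (t + s) \<ge> h t - \<epsilon> * s"
    and T: "0 \<le> T"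
  shows "h T \<ge> h 0 - \<epsilon> * T"
proof -
  define A where "A = {t. 0 \<le> t \<and> t \<le> T \<and> h t \<ge> h 0 - \<epsilon> * t}"
  have A0: "0 \<in> A" using T by (simp add: A_def)
  have bdd: "bdd_above A" by (auto simp: A_def bdd_above_def)
  define \<sigma> where "\<sigma> = Sup A"
  have \<sigma>: "0 \<le> \<sigma>" "\<sigma> \<le> T"
  proof -
    show "0 \<le> \<sigma>" using cSup_upper[OF A0 bdd] by (simp add: \<sigma>_def)
    have "A \<noteq> {}" using A0 by blast
    then show "\<sigma> \<le> T" unfolding \<sigma>_def by (rule cSup_least) (simp add: A_def)
  qed
  have "h \<sigma> - (h 0 - \<epsilon> * \<sigma>) \<ge> 0"
  proof (rule ccontr)
    define gap where "gap = - (h \<sigma> - (h 0 - \<epsilon> * \<sigma>))"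
    assume "\<not> ?thesis"
    then have gap: "gap > 0" by (simp add: gap_def)
    \<comment> \<open>over a time \<open>\<delta>\<close> the function and the linear bound together lose less than \<open>gap\<close>\<close>
    define \<delta> where "\<delta> = gap / (\<bar>L\<bar> + \<bar>\<epsilon>\<bar> + 1)"
    have \<delta>: "\<delta> > 0" using gap by (simp add: \<delta>_def add_nonneg_pos)
    have "\<sigma> - \<delta> < Sup A" using \<delta> by (simp add: \<sigma>_def)
    then obtain t where t: "t \<in> A" "\<sigma> - \<delta> < t"
      using less_cSup_iff[OF _ bdd] A0 by blast
    have "t \<le> \<sigma>" using t bdd by (simp add: \<sigma>_def cSup_upper)
    have "h \<sigma> \<ge> h t - L * (\<sigma> - t)"
      using left[of t "\<sigma> - t"] t \<open>t \<le> \<sigma>\<close> by (simp add: A_def)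
    moreover have "h t \<ge> h 0 - \<epsilon> * t" using t by (simp add: A_def)
    ultimately have "gap \<le> (L - \<epsilon>) * (\<sigma> - t)"
      by (simp add: gap_def algebra_simps)
    also have "\<dots> \<le> (\<bar>L\<bar> + \<bar>\<epsilon>\<bar>) * (\<sigma> - t)"
      using \<open>t \<le> \<sigma>\<close> by (intro mult_right_mono) auto
    also have "\<dots> \<le> (\<bar>L\<bar> + \<bar>\<epsilon>\<bar>) * \<delta>"
      using t by (intro mult_left_mono) auto
    also have "\<dots> < (\<bar>L\<bar> + \<bar>\<epsilon>\<bar> + 1) * \<delta>" using \<delta> by (simp add: algebra_simps)
    also have "\<dots> = gap" by (simp add: \<delta>_def add_nonneg_pos less_imp_neq[symmetric] add_nonneg_eq_0_iff)
    finally show False by simp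
  qed
  then have \<sigma>A: "h \<sigma> \<ge> h 0 - \<epsilon> * \<sigma>" by simp
  have "\<sigma> = T"
  proof (rule ccontr)
    assume "\<sigma> \<noteq> T"
    then have "T - \<sigma> > 0" using \<sigma> by simp
    then obtain s where s: "0 < s" "s < T - \<sigma>" "h (\<sigma> + s) \<ge> h \<sigma> - \<epsilon> * s"
      using right \<sigma>(1) by blast
    have "\<sigma> + s \<in> A" using s \<sigma> \<sigma>A by (auto simp: A_def algebra_simps)
    then have "\<sigma> + s \<le> Sup A" using bdd by (rule cSup_upper)
    with s show False by (simp add: \<sigma>_def)
  qed
  with \<sigma>A show ?thesis by simp
qed

text \<open>Let \<open>h t\<close> be the probability of being in \<open>C\<close> at time \<open>t\<close>. By the Markov property, the decrease of
  \<open>h\<close> over \<open>[t, t + s]\<close>, divided by \<open>s\<close>, is at most the expectation of \<open>(1 - P\<^sub>s(y, C)) / s\<close> over the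
  states \<open>y \<in> C\<close> at time \<open>t\<close>. This tends to \<open>0\<close> for each \<open>y\<close> by assumption, and the holding
  probabilities bound it by \<open>\<bar>\<Lambda>\<bar>\<close>, so that dominated convergence applies.\<close>

lemma closed_set_absorbing:
  assumes mp: "markov_process S P" and gen: "has_generator S P Q"
    and rate: "\<And>y. y \<in> S \<Longrightarrow> Q (indicator {y}) y > - \<Lambda>"
    and closed: "\<And>y. y \<in> S \<Longrightarrow> y \<in> C \<Longrightarrow> Q (indicator C) y = 0"
    and x: "x \<in> S" "x \<in> C" and t: "t \<ge> 0"
  shows "measure_pmf.prob (P t x) C = 1"
proof -
  define h where "h t = measure_pmf.prob (P t x) C" for t
  have in_S: "set_pmf (P t y) \<subseteq> S" if "t \<ge> 0" "y \<in> S" for t y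
    using mp that by (auto simp: markov_process_def)
  have h_add: "h (t + s) = measure_pmf.expectation (P t x) (\<lambda>y. measure_pmf.prob (P s y) C)"
    if "t \<ge> 0" "s \<ge> 0" for t s
  proof -
    have "P (t + s) x = bind_pmf (P t x) (P s)" using mp x that by (auto simp: markov_process_def)
    then show ?thesis by (simp add: h_def measure_bind_pmf_eq)
  qed
  have h_range: "0 \<le> h t" "h t \<le> 1" for t by (auto simp: h_def)
  have h0: "h 0 = 1" using mp x by (auto simp: h_def markov_process_def)
  define loss where "loss s y = indicator C y * (1 - measure_pmf.prob (P s y) C) / s" for s y
  \<comment> \<open>the dominating constant: leaving \<open>C\<close> from \<open>y \<in> C\<close> requires leaving \<open>y\<close>\<close>
  have loss_bound: "0 \<le> loss s y" "loss s y \<le> \<bar>\<Lambda>\<bar>" if "s > 0" "y \<in> S" for s y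
  proof -
    show "0 \<le> loss s y" using that by (auto simp: loss_def indicator_def)
    show "loss s y \<le> \<bar>\<Lambda>\<bar>"
    proof (cases "y \<in> C")
      case True
      have "1 - \<Lambda> * s \<le> pmf (P s y) y"
        using holding_probability_ge[OF mp gen that(2) rate] that by simp
      also have "\<dots> \<le> measure_pmf.prob (P s y) C"
        unfolding measure_pmf_single[symmetric] using True by (intro measure_pmf.finite_measure_mono) auto
      finally have "1 - measure_pmf.prob (P s y) C \<le> \<bar>\<Lambda>\<bar> * s"
        using that abs_ge_self[of \<Lambda>] mult_right_mono[of \<Lambda> "\<bar>\<Lambda>\<bar>" s] by linarith
      then show ?thesis using that True by (simp add: loss_def field_simps)
    qed (simp add: loss_def)
  qed
  have loss_lim: "((\<lambda>s. loss s y) \<longlongrightarrow> 0) (at_right 0)" if "y \<in> S" for y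
  proof (cases "y \<in> C")
    case True
    have "bounded ((indicator C :: _ \<Rightarrow> real) ` S)"
      by (rule boundedI[of _ 1]) (auto simp: indicator_def)
    then have "((\<lambda>s. (measure_pmf.expectation (P s y) (indicator C) - indicator C y) / s) \<longlongrightarrow> Q (indicator C) y) (at_right 0)"
      using gen that unfolding has_generator_def by blast
    then have "((\<lambda>s. - ((measure_pmf.prob (P s y) C - 1) / s)) \<longlongrightarrow> - 0) (at_right 0)"
      using closed[OF that True] True by (intro tendsto_minus) simp
    moreover have "- ((measure_pmf.prob (P s y) C - 1) / s) = loss s y" for s
      using True by (simp add: loss_def diff_divide_distrib)
    ultimately show ?thesis by simp
  qed (simp add: loss_def)
  \<comment> \<open>staying at \<open>x\<close> for time \<open>s\<close> and then going from \<open>x\<close> into \<open>C\<close> in time \<open>t\<close> is one way to be in \<open>C\<close> at time \<open>t + s\<close>\<close>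
  have left: "h (t + s) \<ge> h t - \<bar>\<Lambda>\<bar> * s" if "t \<ge> 0" "s \<ge> 0" for t s
  proof -
    have "pmf (P s x) x * h t \<le> h (s + t)"
      using pmf_mult_le_expectation[of "\<lambda>y. measure_pmf.prob (P t y) C" 1 "P s x" x] h_add[of s t] that
      by (simp add: h_def)
    moreover have "pmf (P s x) x \<ge> 1 - \<bar>\<Lambda>\<bar> * s"
      using holding_probability_ge[OF mp gen x(1) rate[OF x(1)], of s] that
        mult_right_mono[of \<Lambda> "\<bar>\<Lambda>\<bar>" s] by linarith
    then have "(1 - \<bar>\<Lambda>\<bar> * s) * h t \<le> pmf (P s x) x * h t"
      using h_range by (intro mult_right_mono) auto
    moreover have "\<bar>\<Lambda>\<bar> * s * h t \<le> \<bar>\<Lambda>\<bar> * s" using h_range that by (simp add: mult_left_le)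
    ultimately show ?thesis by (simp add: algebra_simps)
  qed
  have right: "\<exists>s. 0 < s \<and> s < \<delta> \<and> h (t + s) \<ge> h t - \<epsilon> * s" if "0 \<le> t" "0 < \<delta>" "0 < \<epsilon>" for t \<delta> \<epsilon>
  proof -
    have seq: "filterlim (\<lambda>k. inverse (real (Suc k))) (at_right 0) sequentially"
      using LIMSEQ_inverse_real_of_nat by (auto simp: filterlim_at)
    have "(\<lambda>k. measure_pmf.expectation (P t x) (loss (inverse (real (Suc k)))))
        \<longlonglongrightarrow> measure_pmf.expectation (P t x) (\<lambda>y. 0)"
    proof (rule integral_dominated_convergence[where w="\<lambda>_. \<bar>\<Lambda>\<bar>"])
      show "AE y in P t x. (\<lambda>k. loss (inverse (real (Suc k))) y) \<longlonglongrightarrow> 0"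
        using in_S[OF that(1) x(1)] filterlim_compose[OF loss_lim seq]
        by (auto simp: AE_measure_pmf_iff)
      show "AE y in P t x. norm (loss (inverse (real (Suc k))) y) \<le> \<bar>\<Lambda>\<bar>" for k
        using in_S[OF that(1) x(1)] loss_bound[of "inverse (real (Suc k))"]
        by (auto simp: AE_measure_pmf_iff)
    qed auto
    then have "eventually (\<lambda>k. measure_pmf.expectation (P t x) (loss (inverse (real (Suc k)))) < \<epsilon>) sequentially"
      using that(3) by (intro order_tendstoD) auto
    moreover have "eventually (\<lambda>k. inverse (real (Suc k)) < \<delta>) sequentially"
      using LIMSEQ_inverse_real_of_nat that(2) by (rule order_tendstoD)
    ultimately have "eventually (\<lambda>k. measure_pmf.expectation (P t x) (loss (inverse (real (Suc k)))) < \<epsilon>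
        \<and> inverse (real (Suc k)) < \<delta>) sequentially" by (rule eventually_conj)
    then obtain k where k: "measure_pmf.expectation (P t x) (loss (inverse (real (Suc k)))) < \<epsilon>"
      "inverse (real (Suc k)) < \<delta>" by (auto simp: eventually_sequentially)
    define s where "s = inverse (real (Suc k))"
    have s: "0 < s" by (simp add: s_def)
    have int_loss: "integrable (P t x) (loss s)"
      using in_S[OF that(1) x(1)] loss_bound[OF s]
      by (intro measure_pmf.integrable_const_bound[where B="\<bar>\<Lambda>\<bar>"]) (auto simp: AE_measure_pmf_iff)
    have "h t - s * measure_pmf.expectation (P t x) (loss s)
        = measure_pmf.expectation (P t x) (\<lambda>y. indicator C y - s * loss s y)"
      using int_loss
      by (subst Bochner_Integration.integral_diff)
         (auto simp: h_def indicator_def intro!: measure_pmf.integrable_const_bound[where B=1])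
    also have "\<dots> \<le> measure_pmf.expectation (P t x) (\<lambda>y. measure_pmf.prob (P s y) C)"
      using int_loss s
      by (intro integral_mono Bochner_Integration.integrable_diff integrable_mult_right
          measure_pmf.integrable_const_bound[where B=1] ) (auto simp: loss_def indicator_def)
    also have "\<dots> = h (t + s)" using h_add[of t s] that s by simp
    finally have "h t - s * measure_pmf.expectation (P t x) (loss s) \<le> h (t + s)" .
    moreover have "s * measure_pmf.expectation (P t x) (loss s) \<le> s * \<epsilon>"
      using k s by (intro mult_left_mono) (auto simp: s_def)
    ultimately have "h (t + s) \<ge> h t - \<epsilon> * s" by (simp add: mult.commute)
    moreover have "s < \<delta>" using k(2) by (simp add: s_def)
    ultimately show ?thesis using s by blast
  qed
  have "h t \<ge> 1 - \<epsilon> * t" if "\<epsilon> > 0" for \<epsilon>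
    using ge_if_right_increments_ge[of h "\<bar>\<Lambda>\<bar>" \<epsilon> t, OF left right[OF _ _ that] t] h0 by simp
  then have "1 - h t \<le> \<epsilon> * t" if "\<epsilon> > 0" for \<epsilon> using that by (simp add: algebra_simps)
  then have "1 - h t \<le> 0 + e" if "e > 0" for e
  proof -
    have "1 - h t \<le> e / (t + 1) * t" using \<open>\<And>\<epsilon>. \<epsilon> > 0 \<Longrightarrow> 1 - h t \<le> \<epsilon> * t\<close>[of "e / (t + 1)"] that t by simp
    also have "\<dots> \<le> e" using that t by (simp add: field_simps)
    finally show ?thesis by simp
  qed
  then have "1 - h t \<le> 0" by (rule field_le_epsilon)
  with h_range[of t] have "h t = 1" by simp
  then show ?thesis by (simp add: h_def)
qed

text \<open>If \<open>C\<close> and \<open>C'\<close> were disjoint, every state would lie outside one of them and would thus have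
  limiting probability \<open>0\<close>, as seen from a start in that one.\<close>

lemma ergodic_closed_sets_intersect:
  assumes mp: "markov_process S P" and gen: "has_generator S P Q" and erg: "ergodic S P"
    and rate: "\<And>y. y \<in> S \<Longrightarrow> Q (indicator {y}) y > - \<Lambda>"
    and closed: "\<And>y. y \<in> S \<Longrightarrow> y \<in> C \<Longrightarrow> Q (indicator C) y = 0"
      "\<And>y. y \<in> S \<Longrightarrow> y \<in> C' \<Longrightarrow> Q (indicator C') y = 0"
    and x: "x \<in> S" "x \<in> C" and x': "x' \<in> S" "x' \<in> C'"
  shows "C \<inter> C' \<noteq> {}"
proof
  assume disj: "C \<inter> C' = {}"
  obtain p where p: "set_pmf p \<subseteq> S"
    "\<And>x y. x \<in> S \<Longrightarrow> y \<in> S \<Longrightarrow> ((\<lambda>t. pmf (P t x) y) \<longlongrightarrow> pmf p y) at_top"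
    using erg by (auto simp: ergodic_def)
  have outside: "pmf p y = 0" if y: "y \<in> S" "y \<notin> K" and K: "\<And>y. y \<in> S \<Longrightarrow> y \<in> K \<Longrightarrow> Q (indicator K) y = 0"
    and z: "z \<in> S" "z \<in> K" for y K z
  proof -
    have "pmf (P t z) y = 0" if "t \<ge> 0" for t
    proof -
      have "measure_pmf.prob (P t z) K = 1"
        by (rule closed_set_absorbing[OF mp gen rate K z that])
      then have "set_pmf (P t z) \<subseteq> K"
        by (simp add: measure_pmf.prob_eq_1 AE_measure_pmf_iff subset_iff)
      then show ?thesis using y by (auto simp: set_pmf_iff)
    qed
    then have "((\<lambda>t. pmf (P t z) y) \<longlongrightarrow> 0) at_top"
      by (intro tendsto_eventually eventually_mono[OF eventually_ge_at_top[of 0]]) auto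
    then show ?thesis using p(2)[OF z(1) y(1)] by (metis tendsto_unique trivial_limit_at_top_linorder)
  qed
  have "pmf p y = 0" if "y \<in> S" for y
    using disj outside[of y C x] outside[of y C' x'] that closed x x' by blast
  then have "set_pmf p = {}" using p(1) by (auto simp: set_pmf_iff)
  then show False by (simp add: set_pmf_not_empty)
qed

section \<open>Square summability and moves of a weighted set\<close>

lemma has_sum_finite_sum:
  fixes F :: "'i \<Rightarrow> 'a \<Rightarrow> 'b :: topological_comm_monoid_add"
  assumes "finite I" "\<And>i. i \<in> I \<Longrightarrow> (F i has_sum s i) A"
  shows "((\<lambda>x. \<Sum>i\<in>I. F i x) has_sum (\<Sum>i\<in>I. s i)) A"
  using assms
proof (induction I rule: finite_induct)
  case (insert i I)
  have "((\<lambda>x. F i x + (\<Sum>i\<in>I. F i x)) has_sum s i + (\<Sum>i\<in>I. s i)) A"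
    using insert by (intro has_sum_add) blast+
  then show ?case using insert.hyps by simp
qed simp

lemma summable_on_finite_sum:
  fixes F :: "'i \<Rightarrow> 'a \<Rightarrow> 'b :: {topological_comm_monoid_add, t2_space}"
  assumes "finite I" "\<And>i. i \<in> I \<Longrightarrow> F i summable_on A"
  shows "(\<lambda>x. \<Sum>i\<in>I. F i x) summable_on A"
  by (rule has_sum_imp_summable[OF has_sum_finite_sum[OF assms(1) has_sum_infsum[OF assms(2)]]])

lemma has_sum_finite_Times:
  fixes F :: "'i \<Rightarrow> 'a \<Rightarrow> 'b :: topological_comm_monoid_add"
  assumes "finite I" "\<And>i. i \<in> I \<Longrightarrow> (F i has_sum s i) A"
  shows "((\<lambda>(i, x). F i x) has_sum (\<Sum>i\<in>I. s i)) (I \<times> A)"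
proof -
  have "((\<lambda>(i, x). F i x) has_sum (\<Sum>i\<in>I. s i)) (\<Union>i\<in>I. Pair i ` A)"
  proof (rule sum_has_sum[OF assms(1)])
    show "((\<lambda>(i, x). F i x) has_sum s i) (Pair i ` A)" if "i \<in> I" for i
      using assms(2)[OF that] by (subst has_sum_reindex) (auto simp: inj_on_def o_def)
  qed auto
  also have "(\<Union>i\<in>I. Pair i ` A) = I \<times> A" by auto
  finally show ?thesis .
qed

text \<open>The function \<open>c\<close> is the rate of the move \<open>T\<close> and \<open>flow\<close> compares the flow out of \<open>x\<close> with the weight
  of its target. By \<open>\<bar>f g\<bar> \<le> f\<^sup>2 + g\<^sup>2\<close> the terms are dominated by \<open>M w f\<^sup>2\<close> plus \<open>K (w g\<^sup>2) \<circ> T\<close>, and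
  the latter is summable where \<open>c \<noteq> 0\<close> since \<open>T\<close> is injective there.\<close>

lemma summable_on_weighted_transition:
  fixes w c f g :: "'a \<Rightarrow> real"
  assumes w: "\<And>x. x \<in> A \<Longrightarrow> 0 \<le> w x" and c: "\<And>x. x \<in> A \<Longrightarrow> 0 \<le> c x" "\<And>x. x \<in> A \<Longrightarrow> c x \<le> M"
    and T: "\<And>x. x \<in> A \<Longrightarrow> c x \<noteq> 0 \<Longrightarrow> T x \<in> A" "inj_on T {x \<in> A. c x \<noteq> 0}"
    and flow: "\<And>x. x \<in> A \<Longrightarrow> c x \<noteq> 0 \<Longrightarrow> w x * c x \<le> K * w (T x)"
    and f: "(\<lambda>x. w x * (f x)\<^sup>2) summable_on A" and g: "(\<lambda>x. w x * (g x)\<^sup>2) summable_on A"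
  shows "(\<lambda>x. w x * (c x * f x * g (T x))) summable_on A"
proof -
  define B where "B = {x \<in> A. c x \<noteq> 0}"
  have "(\<lambda>x. w x * (g x)\<^sup>2) summable_on T ` B"
    using T(1) by (intro summable_on_subset[OF g]) (auto simp: B_def)
  then have "(\<lambda>x. w (T x) * (g (T x))\<^sup>2) summable_on B"
    using T(2) by (simp add: summable_on_reindex B_def o_def)
  then have gT: "(\<lambda>x. indicator B x * (w (T x) * (g (T x))\<^sup>2)) summable_on A"
    by (subst summable_on_cong_neutral[where T=B]) (auto simp: B_def)
  have "(\<lambda>x. M * (w x * (f x)\<^sup>2) + K * (indicator B x * (w (T x) * (g (T x))\<^sup>2))) summable_on A"
    by (intro summable_on_add summable_on_cmult_right f gT)
  then have "(\<lambda>x. norm (w x * (c x * f x * g (T x)))) summable_on A"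
  proof (rule Infinite_Sum.abs_summable_on_comparison_test')
    fix x assume x: "x \<in> A"
    have "c x * (w x * (f x)\<^sup>2) \<le> M * (w x * (f x)\<^sup>2)"
      using w[OF x] by (intro mult_right_mono c(2)[OF x]) simp
    moreover have "w x * c x * (g (T x))\<^sup>2 \<le> K * (indicator B x * (w (T x) * (g (T x))\<^sup>2))"
    proof (cases "c x = 0")
      case False
      then have "w x * c x * (g (T x))\<^sup>2 \<le> K * w (T x) * (g (T x))\<^sup>2"
        by (intro mult_right_mono flow[OF x]) simp_all
      then show ?thesis using False x by (simp add: B_def mult.assoc)
    qed (simp add: B_def)
    moreover have "\<bar>f x * g (T x)\<bar> \<le> (f x)\<^sup>2 + (g (T x))\<^sup>2"
    proof -
      have "2 * (\<bar>f x\<bar> * \<bar>g (T x)\<bar>) \<le> (f x)\<^sup>2 + (g (T x))\<^sup>2"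
        using sum_squares_bound[of "\<bar>f x\<bar>" "\<bar>g (T x)\<bar>"] by (simp add: mult.assoc)
      moreover have "0 \<le> \<bar>f x\<bar> * \<bar>g (T x)\<bar>" by simp
      ultimately show ?thesis unfolding abs_mult by linarith
    qed
    then have "w x * c x * \<bar>f x * g (T x)\<bar> \<le> w x * c x * ((f x)\<^sup>2 + (g (T x))\<^sup>2)"
      using w[OF x] c(1)[OF x] by (intro mult_left_mono) simp_all
    moreover have "norm (w x * (c x * f x * g (T x))) = w x * c x * \<bar>f x * g (T x)\<bar>"
      using w[OF x] c(1)[OF x] by (simp add: abs_mult mult.assoc)
    moreover have "w x * c x * ((f x)\<^sup>2 + (g (T x))\<^sup>2)
        = c x * (w x * (f x)\<^sup>2) + w x * c x * (g (T x))\<^sup>2"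
      by (simp add: distrib_left)
    ultimately show "norm (w x * (c x * f x * g (T x)))
        \<le> M * (w x * (f x)\<^sup>2) + K * (indicator B x * (w (T x) * (g (T x))\<^sup>2))"
      by linarith
  qed
  then show ?thesis by (rule summable_on_iff_abs_summable_on_real[THEN iffD2])
qed

lemma summable_on_weighted_jump:
  fixes w c f g :: "'a \<Rightarrow> real"
  assumes w: "\<And>x. x \<in> A \<Longrightarrow> 0 \<le> w x" and c: "\<And>x. x \<in> A \<Longrightarrow> 0 \<le> c x" "\<And>x. x \<in> A \<Longrightarrow> c x \<le> M"
    and T: "\<And>x. x \<in> A \<Longrightarrow> c x \<noteq> 0 \<Longrightarrow> T x \<in> A" "inj_on T {x \<in> A. c x \<noteq> 0}"
    and flow: "\<And>x. x \<in> A \<Longrightarrow> c x \<noteq> 0 \<Longrightarrow> w x * c x \<le> K * w (T x)"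
    and f: "(\<lambda>x. w x * (f x)\<^sup>2) summable_on A" and g: "(\<lambda>x. w x * (g x)\<^sup>2) summable_on A"
  shows "(\<lambda>x. w x * (f x * (c x * (g (T x) - g x)))) summable_on A"
proof -
  have "(\<lambda>x. w x * (c x * f x * g (T x))) summable_on A"
    by (rule summable_on_weighted_transition[OF w c T flow f g])
  moreover have "(\<lambda>x. w x * (c x * f x * g (id x))) summable_on A"
  proof (rule summable_on_weighted_transition[OF w c _ _ _ f g])
    show "w x * c x \<le> M * w (id x)" if "x \<in> A" for x
      using mult_right_mono[OF c(2)[OF that] w[OF that]] by (simp add: mult.commute)
  qed auto
  ultimately have "(\<lambda>x. w x * (c x * f x * g (T x)) + (-1) * (w x * (c x * f x * g (id x)))) summable_on A"
    by (intro summable_on_add summable_on_cmult_right)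
  then show ?thesis by (simp add: algebra_simps)
qed

lemma integral_point_measure_eq_infsum:
  fixes w F :: "'a \<Rightarrow> real"
  assumes w: "\<And>x. x \<in> A \<Longrightarrow> 0 \<le> w x"
    and W: "\<And>x. x \<in> A \<Longrightarrow> W x = ennreal (w x)"
  shows "integrable (point_measure A W) F \<longleftrightarrow> (\<lambda>x. w x * F x) summable_on A"
    and "(\<lambda>x. w x * F x) summable_on A \<Longrightarrow>
      integral\<^sup>L (point_measure A W) F = (\<Sum>\<^sub>\<infinity>x\<in>A. w x * F x)"
proof -
  have M: "point_measure A W = density (count_space A) (\<lambda>x. ennreal (w x))"
    unfolding point_measure_def by (rule density_cong) (auto simp: AE_count_space W)
  have abs: "Infinite_Set_Sum.abs_summable_on (\<lambda>x. w x * F x) A \<longleftrightarrow> (\<lambda>x. w x * F x) summable_on A"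
    unfolding abs_summable_equivalent[symmetric] by (rule summable_on_iff_abs_summable_on_real[symmetric])
  show "integrable (point_measure A W) F \<longleftrightarrow> (\<lambda>x. w x * F x) summable_on A"
    unfolding M abs[symmetric] Infinite_Set_Sum.abs_summable_on_def
    by (subst integrable_density) (auto simp: AE_count_space w)
  assume "(\<lambda>x. w x * F x) summable_on A"
  then have "infsetsum (\<lambda>x. w x * F x) A = (\<Sum>\<^sub>\<infinity>x\<in>A. w x * F x)"
    using abs infsetsum_infsum by blast
  then show "integral\<^sup>L (point_measure A W) F = (\<Sum>\<^sub>\<infinity>x\<in>A. w x * F x)"
    unfolding M infsetsum_def by (subst integral_density) (auto simp: AE_count_space w)
qed

section \<open>Queue length vectors and the generators\<close>

lemma finite_nodes [simp]: "finite (nodes N)" by (simp add: nodes_def)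

lemma inc_vecs: "j \<in> K \<Longrightarrow> n \<in> vecs K \<Longrightarrow> inc j n \<in> vecs K"
  by (auto simp: vecs_def inc_def PiE_iff extensional_def)

lemma dec_vecs: "j \<in> K \<Longrightarrow> n \<in> vecs K \<Longrightarrow> dec j n \<in> vecs K"
  by (auto simp: vecs_def dec_def PiE_iff extensional_def)

lemma inj_inc: "inj_on (inc j) X"
proof (rule inj_on_inverseI)
  show "dec j (inc j n) = n" for n by (simp add: inc_def dec_def)
qed

lemma inj_dec: "(\<And>n. n \<in> X \<Longrightarrow> n j > 0) \<Longrightarrow> inj_on (dec j) X"
proof (rule inj_on_inverseI)
  show "inc j (dec j n) = n" if "\<And>n. n \<in> X \<Longrightarrow> n j > 0" "n \<in> X" for n
    using that by (simp add: inc_def dec_def)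
qed

lemma inc_merge: "j \<notin> D \<Longrightarrow> j \<in> E \<Longrightarrow> inc j (merge D E (u, v)) = merge D E (u, inc j v)"
  by (auto simp: inc_def merge_def fun_eq_iff)

lemma dec_merge: "j \<notin> D \<Longrightarrow> j \<in> E \<Longrightarrow> dec j (merge D E (u, v)) = merge D E (u, dec j v)"
  by (auto simp: dec_def merge_def fun_eq_iff)

lemma bij_betw_merge_vecs:
  assumes "D \<inter> E = {}"
  shows "bij_betw (merge D E) (vecs D \<times> vecs E) (vecs (D \<union> E))"
proof (rule bij_betw_byWitness[where f' = "\<lambda>n. (restrict n D, restrict n E)"])
  show "\<forall>p\<in>vecs D \<times> vecs E. (restrict (merge D E p) D, restrict (merge D E p) E) = p"
    using assms
    by (auto simp: vecs_def merge_def PiE_iff extensional_def restrict_def fun_eq_iff)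
  show "\<forall>n\<in>vecs (D \<union> E). merge D E (restrict n D, restrict n E) = n"
    by (auto simp: vecs_def merge_def PiE_iff extensional_def restrict_def fun_eq_iff)
qed (auto simp: vecs_def merge_def PiE_iff extensional_def restrict_def)

lemma queue_dist_merge:
  assumes "finite D" "finite E" "D \<inter> E = {}"
  shows "queue_dist N (D \<union> E) (merge D E (u, v)) = queue_dist N D u * queue_dist N E v"
proof -
  have D: "merge D E (u, v) j = u j" if "j \<in> D" for j using that by (simp add: merge_def)
  have E: "merge D E (u, v) j = v j" if "j \<in> E" for j using that assms(3) by (auto simp: merge_def)
  show ?thesis
    unfolding queue_dist_def prod.union_disjoint[OF assms]
    by (intro arg_cong2[of _ _ _ _ "(*)"] prod.cong refl) (simp_all only: D E)
qed

text \<open>The generator reads and moves only the coordinates outside \<open>D\<close>, so it does not matter whether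
  those of \<open>u\<close> are filled in before or after applying it.\<close>

lemma QX_merge:
  "QX N D (\<lambda>m. h (merge D (nodes N - D) (u, m))) v = QX N D h (merge D (nodes N - D) (u, v))"
proof -
  have at: "merge D (nodes N - D) (u, v) j = v j" if "j \<in> nodes N - D" for j
    using that by (simp add: merge_def)
  have inc: "inc j (merge D (nodes N - D) (u, m)) = merge D (nodes N - D) (u, inc j m)"
    if "j \<in> nodes N - D" for j m
    using that by (intro inc_merge) auto
  have dec: "dec j (merge D (nodes N - D) (u, m)) = merge D (nodes N - D) (u, dec j m)"
    if "j \<in> nodes N - D" for j m
    using that by (intro dec_merge) auto
  show ?thesis
    unfolding QX_def by (intro arg_cong2[of _ _ _ _ "(+)"] sum.cong refl) (simp_all only: at inc dec)
qed

lemma QZ_eq_QX_plus_QY: "QZ N f (D, n) = QX N D (\<lambda>m. f (D, m)) n + QY N (\<lambda>I. f (I, n)) D"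
  by (simp add: QZ_def QX_def sum_distrib_left mult.assoc)

section \<open>Invariant vectors of irreducible stochastic matrices\<close>

text \<open>If \<open>v b = 0\<close>, the nonnegative terms \<open>v a * r a b\<close> of the balance at \<open>b\<close> all vanish; zeros thus spread
  backwards along the positive entries of \<open>r\<close>.\<close>

lemma stationary_nonneg_vanishes:
  fixes v :: "nat \<Rightarrow> real"
  assumes fin: "finite S" and irr: "irreducible_on S r" and st: "stochastic_on S r"
    and inv: "\<And>j. j \<in> S \<Longrightarrow> v j = (\<Sum>i\<in>S. v i * r i j)"
    and nonneg: "\<And>i. i \<in> S \<Longrightarrow> 0 \<le> v i" and k: "k \<in> S" "v k = 0" and i: "i \<in> S"
  shows "v i = 0"
proof -
  have pred: "v a = 0" if "a \<in> S" "b \<in> S" "r a b > 0" "v b = 0" for a b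
  proof -
    have "(\<Sum>i\<in>S. v i * r i b) = 0" using inv that by simp
    then have "v a * r a b = 0"
      using fin nonneg st that by (subst (asm) sum_nonneg_eq_0_iff) (auto simp: stochastic_on_def)
    with that show ?thesis by simp
  qed
  have "(i, k) \<in> {(a, b). a \<in> S \<and> b \<in> S \<and> r a b > 0}\<^sup>+"
    using irr i k by (auto simp: irreducible_on_def)
  then show ?thesis using k(2)
    by (induction rule: converse_trancl_induct) (auto intro: pred)
qed

text \<open>The triangle inequality gives \<open>\<le>\<close> in each coordinate. Both sides have the same sum over \<open>j\<close>
  because the rows of \<open>r\<close> sum to one, so equality holds throughout.\<close>

lemma stationary_abs:
  fixes v :: "nat \<Rightarrow> real"
  assumes fin: "finite S" and st: "stochastic_on S r"
    and inv: "\<And>j. j \<in> S \<Longrightarrow> v j = (\<Sum>i\<in>S. v i * r i j)" and j: "j \<in> S"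
  shows "\<bar>v j\<bar> = (\<Sum>i\<in>S. \<bar>v i\<bar> * r i j)"
proof -
  have le: "\<bar>v j\<bar> \<le> (\<Sum>i\<in>S. \<bar>v i\<bar> * r i j)" if "j \<in> S" for j
  proof -
    have "\<bar>v j\<bar> = \<bar>\<Sum>i\<in>S. v i * r i j\<bar>" using inv that by simp
    also have "\<dots> \<le> (\<Sum>i\<in>S. \<bar>v i * r i j\<bar>)" by (rule sum_abs)
    also have "\<dots> = (\<Sum>i\<in>S. \<bar>v i\<bar> * r i j)"
      using st that by (intro sum.cong) (auto simp: abs_mult stochastic_on_def)
    finally show ?thesis .
  qed
  have "(\<Sum>j\<in>S. \<Sum>i\<in>S. \<bar>v i\<bar> * r i j) = (\<Sum>i\<in>S. \<bar>v i\<bar> * (\<Sum>j\<in>S. r i j))"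
    by (subst sum.swap) (simp add: sum_distrib_left)
  also have "\<dots> = (\<Sum>j\<in>S. \<bar>v j\<bar>)" using st by (simp add: stochastic_on_def)
  finally have "(\<Sum>j\<in>S. (\<Sum>i\<in>S. \<bar>v i\<bar> * r i j) - \<bar>v j\<bar>) = 0" by (simp add: sum_subtractf)
  then show ?thesis
    using fin le j by (subst (asm) sum_nonneg_eq_0_iff) auto
qed

lemma mult_ge_uminus: "0 \<le> a \<Longrightarrow> a \<le> K \<Longrightarrow> -1 \<le> d \<Longrightarrow> - K \<le> a * (d::real)"
  using mult_left_mono[of "-1" d a] by simp

section \<open>The unreliable Jackson network\<close>

context unreliable_jackson_network
begin

lemma nodes0_eq: "nodes0 N = insert 0 (nodes N)" and zero_notin_nodes: "0 \<notin> nodes N"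
  by (auto simp: nodes_def nodes0_def)

text \<open>The vector \<open>v\<close>, which is \<open>\<eta>\<close> with the entry \<open>\<lambda>\<close> at node \<open>0\<close>, is invariant under the full routing
  matrix: the traffic equations are the balances at the nodes, and the balance at \<open>0\<close> follows from
  them since the rows sum to one. Then \<open>\<bar>v\<bar> - v\<close> is nonnegative and invariant and is zero at \<open>0\<close>, so
  it vanishes, and \<open>v \<ge> 0\<close>. A zero of \<open>v\<close> would now spread to node \<open>0\<close>, where \<open>v\<close> is \<open>\<lambda> > 0\<close>.\<close>

lemma eta_pos:
  assumes "j \<in> nodes N"
  shows "eta N j > 0"
proof -
  define v where "v = (eta N)(0 := arrival N)"
  define r where "r = routing N"
  have fin: "finite (nodes0 N)" by (simp add: nodes0_eq)
  have st: "stochastic_on (nodes0 N) r" and irr: "irreducible_on (nodes0 N) r"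
    using routing_stochastic routing_irreducible by (simp_all add: r_def)
  have v_eta: "v i = eta N i" if "i \<in> nodes N" for i
    using that zero_notin_nodes by (auto simp: v_def)
  have inv_node: "v k = (\<Sum>i\<in>nodes0 N. v i * r i k)" if k: "k \<in> nodes N" for k
  proof -
    have "(\<Sum>i\<in>nodes0 N. v i * r i k) = v 0 * r 0 k + (\<Sum>i\<in>nodes N. v i * r i k)"
      using zero_notin_nodes by (simp add: nodes0_eq)
    also have "(\<Sum>i\<in>nodes N. v i * r i k) = (\<Sum>i\<in>nodes N. eta N i * r i k)"
      by (simp add: v_eta)
    also have "v 0 * r 0 k + \<dots> = eta N k"
      using traffic k by (simp add: traffic_equations_def v_def r_def)
    finally show ?thesis using v_eta[OF k] by simp
  qed
  have inv_0: "v 0 = (\<Sum>i\<in>nodes0 N. v i * r i 0)"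
  proof -
    have "(\<Sum>i\<in>nodes0 N. v i * r i 0) + (\<Sum>k\<in>nodes N. \<Sum>i\<in>nodes0 N. v i * r i k)
        = (\<Sum>k\<in>nodes0 N. \<Sum>i\<in>nodes0 N. v i * r i k)"
      using zero_notin_nodes by (simp add: nodes0_eq)
    also have "\<dots> = (\<Sum>i\<in>nodes0 N. v i * (\<Sum>k\<in>nodes0 N. r i k))"
      by (subst sum.swap) (simp add: sum_distrib_left)
    also have "\<dots> = (\<Sum>i\<in>nodes0 N. v i)" using st by (simp add: stochastic_on_def)
    also have "\<dots> = v 0 + (\<Sum>k\<in>nodes N. v k)" using zero_notin_nodes by (simp add: nodes0_eq)
    finally show ?thesis by (simp flip: inv_node)
  qed
  have inv: "v k = (\<Sum>i\<in>nodes0 N. v i * r i k)" if "k \<in> nodes0 N" for k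
    using that inv_node inv_0 by (auto simp: nodes0_eq)
  have in0: "0 \<in> nodes0 N" "j \<in> nodes0 N" using assms by (auto simp: nodes0_eq)
  have v0: "v 0 > 0" using arrival_pos by (simp add: v_def)
  have nonneg: "v i \<ge> 0" if i: "i \<in> nodes0 N" for i
  proof -
    have "\<bar>v i\<bar> - v i = 0"
    proof (rule stationary_nonneg_vanishes[OF fin irr st _ _ in0(1) _ i])
      show "\<bar>v k\<bar> - v k = (\<Sum>i\<in>nodes0 N. (\<bar>v i\<bar> - v i) * r i k)" if "k \<in> nodes0 N" for k
        using stationary_abs[OF fin st inv that] inv[OF that]
        by (simp add: left_diff_distrib sum_subtractf)
    qed (use v0 in auto)
    then show ?thesis by simp
  qed
  have "v j \<noteq> 0"
    using stationary_nonneg_vanishes[OF fin irr st inv nonneg in0(2) _ in0(1)] v0 by auto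
  with nonneg[OF in0(2)] show ?thesis using v_eta[OF assms] by simp
qed

lemma serv_nonneg: "j \<in> nodes N \<Longrightarrow> 0 \<le> serv N j k"
  using serv_pos[of j k] serv_0[of j] by (cases "k = 0") auto

lemma serv_bound:
  obtains M where "M \<ge> 0" "\<And>j k. j \<in> nodes N \<Longrightarrow> serv N j k \<le> M"
proof -
  obtain M where M: "\<And>x. x \<in> (\<lambda>(j, k). serv N j k) ` (nodes N \<times> UNIV) \<Longrightarrow> x \<le> M"
    using serv_bounded unfolding bdd_above_def by blast
  then have "serv N j k \<le> max 0 M" if "j \<in> nodes N" for j k
    using that by (fastforce intro: max.coboundedI2)
  then show ?thesis using that[of "max 0 M"] by auto
qed

lemma reroute_range:
  assumes "D \<subseteq> nodes N" "i \<in> nodes0 N - D" "j \<in> nodes0 N - D"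
  shows "0 \<le> reroute N D i j" "reroute N D i j \<le> 1"
proof -
  have st: "stochastic_on (nodes0 N - D) (reroute N D)" using assms reroute_stochastic by blast
  then show "0 \<le> reroute N D i j" using assms by (auto simp: stochastic_on_def)
  have "reroute N D i j \<le> (\<Sum>k\<in>nodes0 N - D. reroute N D i k)"
    using st assms by (intro member_le_sum) (auto simp: stochastic_on_def nodes0_eq)
  then show "reroute N D i j \<le> 1" using st assms by (auto simp: stochastic_on_def)
qed

lemma norm_const_pos:
  assumes j: "j \<in> nodes N"
  shows "norm_const N j > 0"
proof -
  have "0 < (\<Prod>k=1..m. eta N j / serv N j k)" for m
    using eta_pos[OF j] serv_pos[OF j] by (intro prod_pos) auto
  then show ?thesis
    unfolding norm_const_def by (intro suminf_pos jackson_ergodic j)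
qed

lemma queue_dist_pos: "K \<subseteq> nodes N \<Longrightarrow> queue_dist N K n > 0"
  unfolding queue_dist_def
  by (intro prod_pos) (auto intro!: mult_pos_pos prod_pos divide_pos_pos eta_pos serv_pos norm_const_pos)

lemma queue_dist_nonneg: "K \<subseteq> nodes N \<Longrightarrow> 0 \<le> queue_dist N K n"
  using queue_dist_pos less_imp_le by blast

lemma queue_dist_inc:
  assumes "j \<in> nodes N"
  shows "queue_dist N (nodes N) (inc j n) * serv N j (n j + 1) = queue_dist N (nodes N) n * eta N j"
proof -
  have rest: "(\<Prod>i\<in>nodes N - {j}. inverse (norm_const N i) * (\<Prod>k=1..inc j n i. eta N i / serv N i k))
      = (\<Prod>i\<in>nodes N - {j}. inverse (norm_const N i) * (\<Prod>k=1..n i. eta N i / serv N i k))"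
    by (intro prod.cong) (auto simp: inc_def)
  have "serv N j (n j + 1) \<noteq> 0" using serv_pos[OF assms, of "n j + 1"] by simp
  then show ?thesis
    unfolding queue_dist_def prod.remove[OF finite_nodes assms] rest
    by (simp add: inc_def prod.nat_ivl_Suc' field_simps)
qed

lemma queue_dist_dec:
  assumes "j \<in> nodes N" "n j > 0"
  shows "queue_dist N (nodes N) n * serv N j (n j) = queue_dist N (nodes N) (dec j n) * eta N j"
proof -
  have "inc j (dec j n) = n" using assms by (simp add: inc_def dec_def)
  then show ?thesis using queue_dist_inc[OF assms(1), of "dec j n"] assms(2) by (simp add: dec_def)
qed

lemma queue_dist_le_inc:
  assumes j: "j \<in> nodes N" and M: "\<And>k. serv N j k \<le> M"
  shows "queue_dist N (nodes N) n \<le> M / eta N j * queue_dist N (nodes N) (inc j n)"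
proof -
  have "queue_dist N (nodes N) n * eta N j \<le> queue_dist N (nodes N) (inc j n) * M"
    unfolding queue_dist_inc[OF j, symmetric]
    using queue_dist_pos[of "nodes N" "inc j n"] by (intro mult_left_mono M) auto
  then show ?thesis using eta_pos[OF j] by (simp add: field_simps)
qed

text \<open>The rate of an arrival is constant, and a departure from \<open>j\<close> or a transfer from \<open>j\<close> to \<open>i\<close> has rate
  \<open>\<mu>\<^sub>j(n\<^sub>j)\<close> up to routing probabilities. That factor makes the moves injective where it counts, since
  it vanishes at \<open>n\<^sub>j = 0\<close>. The flow bounds are ratios of the product form, with \<open>M\<close> a bound for \<open>\<mu>\<close>:
  \<open>\<pi>(n) \<le> (M/\<eta>\<^sub>j) \<pi>(n + e\<^sub>j)\<close> and \<open>\<pi>(n) \<mu>\<^sub>j(n\<^sub>j) = \<eta>\<^sub>j \<pi>(n - e\<^sub>j)\<close>.\<close>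

lemma summable_on_QX:
  assumes D: "D \<subseteq> nodes N"
    and f: "(\<lambda>n. queue_dist N (nodes N) n * (f n)\<^sup>2) summable_on vecs (nodes N)"
    and g: "(\<lambda>n. queue_dist N (nodes N) n * (g n)\<^sup>2) summable_on vecs (nodes N)"
  shows "(\<lambda>n. queue_dist N (nodes N) n * (f n * QX N D g n)) summable_on vecs (nodes N)"
proof -
  define w where "w = queue_dist N (nodes N)"
  obtain M where M: "M \<ge> 0" "\<And>j k. j \<in> nodes N \<Longrightarrow> serv N j k \<le> M" using serv_bound by blast
  have w: "0 \<le> w n" for n by (simp add: w_def queue_dist_nonneg)
  note f' = f[folded w_def] and g' = g[folded w_def]
  have pos: "n j > 0" if "j \<in> nodes N" "serv N j (n j) \<noteq> 0" for j and n :: "nat \<Rightarrow> nat"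
    using that serv_0 by (cases "n j") auto
  have inj: "inj_on (dec j) {n \<in> vecs (nodes N). serv N j (n j) \<noteq> 0}" if "j \<in> nodes N" for j
    using pos[OF that] by (intro inj_dec) auto
  have arrive: "(\<lambda>n. w n * (f n * (1 * (g (inc j n) - g n)))) summable_on vecs (nodes N)"
    if "j \<in> nodes N" for j
    using that queue_dist_le_inc[OF that M(2)[OF that]]
    by (intro summable_on_weighted_jump[where M=1 and K="M / eta N j", OF w _ _ _ _ _ f' g'])
       (auto simp: inc_vecs inj_inc w_def)
  have leave: "(\<lambda>n. w n * (f n * (serv N j (n j) * (g (dec j n) - g n)))) summable_on vecs (nodes N)"
    if j: "j \<in> nodes N" for j
  proof (rule summable_on_weighted_jump[where M=M and K="eta N j" and T="dec j", OF w _ _ _ _ _ f' g'])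
    fix n assume n: "n \<in> vecs (nodes N)" "serv N j (n j) \<noteq> 0"
    show "w n * serv N j (n j) \<le> eta N j * w (dec j n)"
      using queue_dist_dec[of j n, OF j pos[where n=n, OF j n(2)]] by (simp add: w_def mult.commute)
  qed (use M(2)[OF j] serv_nonneg[OF j] inj[OF j] dec_vecs[OF j] in auto)
  \<comment> \<open>a transfer is a departure from \<open>j\<close> followed by an arrival at \<open>i\<close>, and the flow bounds multiply\<close>
  have move: "(\<lambda>n. w n * (f n * (serv N j (n j) * (g (inc i (dec j n)) - g n)))) summable_on vecs (nodes N)"
    if j: "j \<in> nodes N" and i: "i \<in> nodes N" for i j
  proof (rule summable_on_weighted_jump[where M=M and K="eta N j * (M / eta N i)"
        and T="\<lambda>n. inc i (dec j n)", OF w _ _ _ _ _ f' g'])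
    show "inj_on (\<lambda>n. inc i (dec j n)) {n \<in> vecs (nodes N). serv N j (n j) \<noteq> 0}"
      using comp_inj_on[OF inj[OF j] inj_inc[of i]] by (simp add: o_def)
    fix n assume n: "n \<in> vecs (nodes N)" "serv N j (n j) \<noteq> 0"
    show "inc i (dec j n) \<in> vecs (nodes N)" by (intro inc_vecs dec_vecs i j n)
    have "w n * serv N j (n j) = eta N j * w (dec j n)"
      using queue_dist_dec[of j n, OF j pos[where n=n, OF j n(2)]] by (simp add: w_def mult.commute)
    also have "\<dots> \<le> eta N j * (M / eta N i * w (inc i (dec j n)))"
      using eta_pos[OF j] queue_dist_le_inc[OF i M(2)[OF i]] by (intro mult_left_mono) (auto simp: w_def)
    finally show "w n * serv N j (n j) \<le> eta N j * (M / eta N i) * w (inc i (dec j n))" by simp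
  qed (use M(2)[OF j] serv_nonneg[OF j] in auto)
  have "(\<lambda>n.
      (\<Sum>j\<in>nodes N - D. arrival N * reroute N D 0 j * (w n * (f n * (1 * (g (inc j n) - g n))))) +
      (\<Sum>j\<in>nodes N - D. reroute N D j 0 * (w n * (f n * (serv N j (n j) * (g (dec j n) - g n))))) +
      (\<Sum>j\<in>nodes N - D. \<Sum>i\<in>nodes N - D. reroute N D j i *
          (w n * (f n * (serv N j (n j) * (g (inc i (dec j n)) - g n)))))) summable_on vecs (nodes N)"
    by (intro summable_on_add summable_on_finite_sum summable_on_cmult_right arrive leave move) auto
  then show ?thesis
    by (simp add: QX_def w_def distrib_left sum_distrib_left mult_ac)
qed

lemma finite_subsets_of_node_set: "D \<subseteq> nodes N \<Longrightarrow> finite {H. H \<subset> D}"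
  by (rule finite_subset[of _ "Pow (nodes N)"]) auto

text \<open>The total rate of leaving a state is bounded uniformly over all states, because the service rates
  are bounded and there are finitely many sets of broken nodes.\<close>

lemma QZ_indicator_ge:
  obtains \<Lambda> where "\<And>y. y \<in> states N \<Longrightarrow> QZ N (indicator {y}) y > - \<Lambda>"
proof -
  obtain M where M: "M \<ge> 0" "\<And>j k. j \<in> nodes N \<Longrightarrow> serv N j k \<le> M" using serv_bound by blast
  define Y where "Y D = (\<Sum>H | H \<subset> D. rep N D / rep N H) + (\<Sum>I | D \<subset> I \<and> I \<subseteq> nodes N. brk N I / brk N D)" for D
  define X where "X D = (\<Sum>j\<in>nodes N - D. arrival N) + (\<Sum>j\<in>nodes N - D. M) + (\<Sum>j\<in>nodes N - D. \<Sum>i\<in>nodes N - D. M)" for D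
  define \<Lambda> where "\<Lambda> = Max ((\<lambda>D. X D + Y D) ` Pow (nodes N)) + 1"
  have "QZ N (indicator {y}) y > - \<Lambda>" if "y \<in> states N" for y
  proof -
    obtain D n where y: "y = (D, n)" by (cases y)
    have D: "D \<subseteq> nodes N" using that by (simp add: y states_def)
    define e :: "_ \<Rightarrow> real" where "e = indicator {y}"
    have e: "e (D, n) = 1" "-1 \<le> e z - e (D, n)" for z by (auto simp: e_def y indicator_def)
    have r: "0 \<le> reroute N D i j" "reroute N D i j \<le> 1"
      if "i = 0 \<or> i \<in> nodes N - D" "j = 0 \<or> j \<in> nodes N - D" for i j
    proof -
      have "i \<in> nodes0 N - D" "j \<in> nodes0 N - D"
        using that D zero_notin_nodes by (auto simp: nodes0_eq)
      then show "0 \<le> reroute N D i j" "reroute N D i j \<le> 1" using reroute_range[OF D] by auto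
    qed
    have s: "0 \<le> serv N j (n j) * reroute N D j i" "serv N j (n j) * reroute N D j i \<le> M"
      if "j \<in> nodes N - D" "i = 0 \<or> i \<in> nodes N - D" for i j
    proof -
      show "0 \<le> serv N j (n j) * reroute N D j i" using that r serv_nonneg by simp
      have "serv N j (n j) * reroute N D j i \<le> M * 1"
        using that M r serv_nonneg by (intro mult_mono) auto
      then show "serv N j (n j) * reroute N D j i \<le> M" by simp
    qed
    have "- X D \<le> QX N D (\<lambda>m. e (D, m)) n"
      unfolding QX_def X_def minus_add_distrib sum_negf[symmetric]
      using arrival_pos r s e(2)
      by (intro add_mono sum_mono mult_ge_uminus) (auto simp: mult_left_le)
    moreover have "- Y D \<le> QY N (\<lambda>I. e (I, n)) D"
      unfolding QY_def Y_def minus_add_distrib sum_negf[symmetric]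
      using D e(2)
      by (intro add_mono sum_mono mult_ge_uminus) (auto intro!: divide_nonneg_nonneg rep_nonneg brk_nonneg)
    moreover have "X D + Y D \<le> Max ((\<lambda>D. X D + Y D) ` Pow (nodes N))"
      using D by (intro Max_ge) auto
    then have "X D + Y D < \<Lambda>" by (simp add: \<Lambda>_def)
    ultimately show ?thesis unfolding e_def[symmetric] by (simp add: y QZ_eq_QX_plus_QY)
  qed
  then show ?thesis using that by blast
qed

text \<open>If \<open>B(I) = 0\<close>, then \<open>B(D) = 0\<close> for every \<open>D \<supseteq> I\<close>, so no repair happens in such a \<open>D\<close>. The node \<open>i\<close>
  remains broken, and a broken node takes no part in any network move.\<close>

lemma frozen_node_closed:
  assumes I: "I \<subseteq> nodes N" "rep N I = 0" and i: "i \<in> I"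
    and y: "y \<in> states N" "y \<in> {(D, n). I \<subseteq> D \<and> n i = c}"
  shows "QZ N (indicator {(D, n). I \<subseteq> D \<and> n i = c}) y = 0"
proof -
  obtain D n where Dn: "y = (D, n)" "D \<subseteq> nodes N" "I \<subseteq> D" "n i = c"
    using y by (auto simp: states_def)
  define e :: "_ \<Rightarrow> real" where "e = indicator {(D, n). I \<subseteq> D \<and> n i = c}"
  have keep: "inc j n i = n i" "dec j n i = n i" if "j \<in> nodes N - D" for j n
    using that i Dn(3) by (auto simp: inc_def dec_def)
  have "QX N D (\<lambda>m. e (D, m)) n = 0"
    unfolding QX_def using Dn by (simp add: e_def keep)
  moreover have "rep N D = 0"
    using I Dn rep_finite[of I D] by (cases "I = D") auto
  then have "QY N (\<lambda>I. e (I, n)) D = 0"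
    unfolding QY_def using Dn subset_trans[OF Dn(3)]
    by (auto simp: e_def indicator_def psubset_eq intro!: sum.neutral)
  ultimately show ?thesis unfolding e_def[symmetric] Dn(1) QZ_eq_QX_plus_QY by simp
qed

text \<open>Otherwise freezing the queue at a node of \<open>I\<close> at length \<open>0\<close> or at length \<open>1\<close> yields two disjoint
  closed sets. A suitable node exists since \<open>B(\<emptyset>) = 1\<close> makes \<open>I\<close> nonempty.\<close>

lemma rep_pos_if_ergodic:
  assumes mp: "markov_process (states N) Z" and gen: "has_generator (states N) Z (QZ N)"
    and erg: "ergodic (states N) Z" and I: "I \<subseteq> nodes N"
  shows "rep N I > 0"
proof (rule ccontr)
  assume "\<not> rep N I > 0"
  then have I0: "rep N I = 0" using rep_nonneg[OF I] by simp
  then have "I \<noteq> {}" using rep_empty by auto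
  then obtain i where i: "i \<in> I" by blast
  obtain \<Lambda> where \<Lambda>: "\<And>y. y \<in> states N \<Longrightarrow> QZ N (indicator {y}) y > - \<Lambda>"
    using QZ_indicator_ge by blast
  define C where "C c = {(D, n::nat\<Rightarrow>nat). I \<subseteq> D \<and> n i = c}" for c
  define x where "x c = (I, restrict (\<lambda>_. c::nat) (nodes N))" for c
  have x: "x c \<in> states N" "x c \<in> C c" for c
    using I i by (auto simp: x_def C_def states_def vecs_def)
  have closed: "QZ N (indicator (C c)) y = 0" if "y \<in> states N" "y \<in> C c" for c y
    using frozen_node_closed[OF I I0 i] that by (simp add: C_def)
  have "C 0 \<inter> C 1 \<noteq> {}"
    by (rule ergodic_closed_sets_intersect[OF mp gen erg \<Lambda> closed closed x x])
  then show False by (auto simp: C_def)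
qed

lemma breakdown_dist_nonneg:
  assumes "D \<subseteq> nodes N"
  shows "breakdown_dist N D \<ge> 0"
  unfolding breakdown_dist_def using assms
  by (intro mult_nonneg_nonneg divide_nonneg_nonneg inverse_nonnegative_iff_nonnegative[THEN iffD2]
      sum_nonneg) (auto intro: brk_nonneg rep_nonneg)

lemma breakdown_dist_eq_0_iff:
  assumes rep: "\<And>I. I \<subseteq> nodes N \<Longrightarrow> rep N I > 0" and D: "D \<subseteq> nodes N"
  shows "breakdown_dist N D = 0 \<longleftrightarrow> brk N D = 0"
proof -
  have "(\<Sum>I\<in>Pow (nodes N). brk N I / rep N I) \<ge> (\<Sum>I\<in>{{}}. brk N I / rep N I)"
    by (intro sum_mono2) (auto intro!: divide_nonneg_nonneg brk_nonneg rep_nonneg)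
  then have "(\<Sum>I\<in>Pow (nodes N). brk N I / rep N I) > 0" by (simp add: brk_empty rep_empty)
  then show ?thesis using rep[OF D] by (simp add: breakdown_dist_def)
qed

text \<open>All sets reached from \<open>D\<close> at a positive rate have positive mass, like \<open>D\<close> itself: a repair leads to a subset \<open>H\<close>
  of \<open>D\<close>, for which \<open>A(H) = 0\<close> would force \<open>A(D) = 0\<close>, and a breakdown to \<open>I\<close> has a rate proportional
  to \<open>A(I)\<close>. So the function \<open>g\<close> is square summable wherever it is evaluated with a nonzero
  coefficient.\<close>

lemma summable_on_QY:
  assumes rep: "\<And>I. I \<subseteq> nodes N \<Longrightarrow> rep N I > 0" and D: "D \<subseteq> nodes N" and bD: "breakdown_dist N D \<noteq> 0"
    and f: "(\<lambda>n. queue_dist N (nodes N) n * (f (D, n))\<^sup>2) summable_on vecs (nodes N)"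
    and g: "\<And>I. I \<subseteq> nodes N \<Longrightarrow> breakdown_dist N I \<noteq> 0 \<Longrightarrow>
      (\<lambda>n. queue_dist N (nodes N) n * (g (I, n))\<^sup>2) summable_on vecs (nodes N)"
  shows "(\<lambda>n. queue_dist N (nodes N) n * (f (D, n) * QY N (\<lambda>I. g (I, n)) D)) summable_on vecs (nodes N)"
proof -
  define w where "w = queue_dist N (nodes N)"
  have w: "0 \<le> w n" for n by (simp add: w_def queue_dist_nonneg)
  have prod: "(\<lambda>n. w n * (f (D, n) * g (I, n))) summable_on vecs (nodes N)"
    if "I \<subseteq> nodes N" "brk N I \<noteq> 0" for I
    using summable_on_weighted_transition[where M=1 and K=1 and c="\<lambda>_. 1" and T=id and w=w
        and f="\<lambda>n. f (D, n)" and g="\<lambda>n. g (I, n)"]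
      w f g that breakdown_dist_eq_0_iff[OF rep] by (simp add: w_def)
  have brkD: "brk N D \<noteq> 0" using bD breakdown_dist_eq_0_iff[OF rep D] by simp
  have jump: "(\<lambda>n. w n * (f (D, n) * (a * (g (I, n) - g (D, n))))) summable_on vecs (nodes N)"
    if "I \<subseteq> nodes N" "brk N I = 0 \<Longrightarrow> a = 0" for I a
  proof (cases "a = 0")
    case False
    then have "(\<lambda>n. a * (w n * (f (D, n) * g (I, n))) + (- a) * (w n * (f (D, n) * g (D, n)))) summable_on vecs (nodes N)"
      using that brkD D by (intro summable_on_add summable_on_cmult_right prod) auto
    then show ?thesis by (simp add: algebra_simps)
  qed simp
  have "(\<lambda>n. (\<Sum>H | H \<subset> D. w n * (f (D, n) * (rep N D / rep N H * (g (H, n) - g (D, n))))) +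
     (\<Sum>I | D \<subset> I \<and> I \<subseteq> nodes N. w n * (f (D, n) * (brk N I / brk N D * (g (I, n) - g (D, n))))))
     summable_on vecs (nodes N)"
    using D brkD brk_finite finite_subsets_of_node_set[OF D]
    by (intro summable_on_add summable_on_finite_sum jump) auto
  then show ?thesis by (simp add: QY_def w_def distrib_left sum_distrib_left)
qed

text \<open>Membership in \<open>L\<^sup>2\<close> says nothing about \<open>f(D, \<cdot>)\<close> when \<open>D\<close> has mass zero; on each other slice it is
  plain square summability with respect to \<open>\<pi>\<close>.\<close>

lemma L2_imp_summable_on:
  assumes f: "f \<in> L2 (stationary_measure N)" and D: "D \<subseteq> nodes N" and bD: "breakdown_dist N D \<noteq> 0"
  shows "(\<lambda>n. queue_dist N (nodes N) n * (f (D, n))\<^sup>2) summable_on vecs (nodes N)"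
proof -
  define w where "w = (\<lambda>(D, n). breakdown_dist N D * queue_dist N (nodes N) n)"
  have w: "0 \<le> w x" if "x \<in> states N" for x
    using that by (auto simp: w_def states_def intro!: mult_nonneg_nonneg breakdown_dist_nonneg queue_dist_nonneg)
  have "(\<lambda>x. w x * (f x)\<^sup>2) summable_on states N"
    using f integral_point_measure_eq_infsum(1)[of "states N" w "\<lambda>x. ennreal (w x)"] w
    by (simp add: L2_def stationary_measure_def w_def case_prod_unfold)
  then have "(\<lambda>n. breakdown_dist N D * (queue_dist N (nodes N) n * (f (D, n))\<^sup>2)) summable_on vecs (nodes N)"
    using summable_on_SigmaD1[of "\<lambda>D n. w (D, n) * (f (D, n))\<^sup>2" "Pow (nodes N)" "\<lambda>_. vecs (nodes N)" D] D
    by (simp add: states_def w_def case_prod_unfold mult_ac)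
  then show ?thesis using summable_on_cmult_right'[OF bD] by blast
qed

lemma infsum_vecs_split:
  assumes D: "D \<subseteq> nodes N"
    and summable: "(\<lambda>n. queue_dist N (nodes N) n * (f n * QX N D g n)) summable_on vecs (nodes N)"
  shows "(\<Sum>\<^sub>\<infinity>n\<in>vecs (nodes N). queue_dist N (nodes N) n * (f n * QX N D g n)) =
    (\<Sum>\<^sub>\<infinity>u\<in>vecs D. queue_dist N D u *
      (\<Sum>\<^sub>\<infinity>v\<in>vecs (nodes N - D). queue_dist N (nodes N - D) v *
         f (merge D (nodes N - D) (u, v)) * QX N D (\<lambda>m. g (merge D (nodes N - D) (u, m))) v))"
proof -
  define E where "E = nodes N - D"
  have DE: "D \<inter> E = {}" "D \<union> E = nodes N" "finite D" "finite E"
    using D by (auto simp: E_def intro: finite_subset)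
  define F where "F n = queue_dist N (nodes N) n * (f n * QX N D g n)" for n
  have bij: "bij_betw (merge D E) (vecs D \<times> vecs E) (vecs (nodes N))"
    using bij_betw_merge_vecs[OF DE(1)] DE(2) by simp
  have "(\<lambda>p. F (merge D E p)) summable_on vecs D \<times> vecs E"
    using summable summable_on_reindex_bij_betw[OF bij, of F] by (simp add: F_def[abs_def])
  then have iterated: "infsum F (vecs (nodes N)) = (\<Sum>\<^sub>\<infinity>u\<in>vecs D. \<Sum>\<^sub>\<infinity>v\<in>vecs E. F (merge D E (u, v)))"
    using infsum_Sigma_banach[of "\<lambda>p. F (merge D E p)" "vecs D" "\<lambda>_. vecs E"]
      infsum_reindex_bij_betw[OF bij, of F] by simp
  have F_merge: "F (merge D E (u, v)) = queue_dist N D u * (queue_dist N E v *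
      f (merge D E (u, v)) * QX N D (\<lambda>m. g (merge D E (u, m))) v)" for u v
    using queue_dist_merge[OF DE(3,4,1), of N u v] QX_merge[of N D g u v]
    by (simp add: F_def DE(2) E_def[symmetric] mult_ac)
  show ?thesis
    using iterated unfolding F_merge infsum_cmult_right' unfolding F_def E_def .
qed

end

theorem proposition3p1:
  fixes N :: network
    and Z :: "real \<Rightarrow> nat set \<times> (nat \<Rightarrow> nat) \<Rightarrow> (nat set \<times> (nat \<Rightarrow> nat)) pmf"
    and f g :: "nat set \<times> (nat \<Rightarrow> nat) \<Rightarrow> real"
  assumes "unreliable_jackson_network N"
    and "markov_process (states N) Z"
    and "has_generator (states N) Z (QZ N)"
    and "ergodic (states N) Z"
    and "f \<in> L2 (stationary_measure N)"
    and "g \<in> L2 (stationary_measure N)"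
  shows "L2_inner (stationary_measure N) f (QZ N g) =
    (\<Sum>\<^sub>\<infinity>n\<in>vecs (nodes N). queue_dist N (nodes N) n *
       (\<Sum>D\<in>Pow (nodes N). breakdown_dist N D * f (D, n) * QY N (\<lambda>I. g (I, n)) D)) +
    (\<Sum>D\<in>Pow (nodes N). breakdown_dist N D *
       (\<Sum>\<^sub>\<infinity>u\<in>vecs D. queue_dist N D u *
          (\<Sum>\<^sub>\<infinity>v\<in>vecs (nodes N - D). queue_dist N (nodes N - D) v *
             f (D, merge D (nodes N - D) (u, v)) *
             QX N D (\<lambda>m. g (D, merge D (nodes N - D) (u, m))) v)))"
proof -
  interpret unreliable_jackson_network N by fact
  define V where "V = vecs (nodes N)"
  define q where "q = queue_dist N (nodes N)"
  define b where "b = breakdown_dist N"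
  define y where "y D n = q n * (b D * f (D, n) * QY N (\<lambda>I. g (I, n)) D)" for D n
  define a where "a D = (\<Sum>\<^sub>\<infinity>u\<in>vecs D. queue_dist N D u *
      (\<Sum>\<^sub>\<infinity>v\<in>vecs (nodes N - D). queue_dist N (nodes N - D) v *
         f (D, merge D (nodes N - D) (u, v)) *
         QX N D (\<lambda>m. g (D, merge D (nodes N - D) (u, m))) v))" for D
  have rep: "rep N I > 0" if "I \<subseteq> nodes N" for I
    using rep_pos_if_ergodic[OF assms(2-4) that] .
  \<comment> \<open>for \<open>b D = 0\<close> nothing is known about \<open>f (D, n)\<close> and \<open>g (D, n)\<close>, but then all terms are zero\<close>
  have x_sum: "((\<lambda>n. b D * (q n * (f (D, n) * QX N D (\<lambda>m. g (D, m)) n))) has_sum b D * a D) V"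
    if D: "D \<subseteq> nodes N" for D
  proof (cases "b D = 0")
    case False
    have "(\<lambda>n. q n * (f (D, n) * QX N D (\<lambda>m. g (D, m)) n)) summable_on V"
      using summable_on_QX[OF D, of "\<lambda>n. f (D, n)" "\<lambda>n. g (D, n)"]
        L2_imp_summable_on[OF assms(5) D] L2_imp_summable_on[OF assms(6) D] False
      by (simp add: q_def b_def V_def)
    then show ?thesis
      using infsum_vecs_split[OF D, of "\<lambda>n. f (D, n)" "\<lambda>n. g (D, n)"]
      by (intro has_sum_cmult_right) (simp add: has_sum_iff q_def V_def a_def)
  qed simp
  have y_sum: "(y D has_sum infsum (y D) V) V" if D: "D \<subseteq> nodes N" for D
  proof (cases "b D = 0")
    case False
    have "(\<lambda>n. b D * (q n * (f (D, n) * QY N (\<lambda>I. g (I, n)) D))) summable_on V"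
      using summable_on_QY[OF rep D, of f g] L2_imp_summable_on[OF assms(5) D]
        L2_imp_summable_on[OF assms(6)] False
      by (intro summable_on_cmult_right) (simp add: q_def b_def V_def)
    moreover have "(\<lambda>n. b D * (q n * (f (D, n) * QY N (\<lambda>I. g (I, n)) D))) = y D"
      by (simp add: fun_eq_iff y_def mult_ac)
    ultimately show ?thesis by simp
  next
    case True
    then have "y D = (\<lambda>_. 0)" by (simp add: fun_eq_iff y_def)
    then show ?thesis by simp
  qed
  have "((\<lambda>n. b D * q n * (f (D, n) * QZ N g (D, n))) has_sum (b D * a D + infsum (y D) V)) V"
    if D: "D \<subseteq> nodes N" for D
    using has_sum_add[OF x_sum[OF D] y_sum[OF D]]
    by (simp add: y_def QZ_eq_QX_plus_QY algebra_simps)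
  then have "((\<lambda>(D, n). b D * q n * (f (D, n) * QZ N g (D, n)))
      has_sum (\<Sum>D\<in>Pow (nodes N). b D * a D + infsum (y D) V)) (Pow (nodes N) \<times> V)"
    by (intro has_sum_finite_Times) auto
  then have total: "((\<lambda>x. (case x of (D, n) \<Rightarrow> b D * q n) * (f x * QZ N g x))
      has_sum (\<Sum>D\<in>Pow (nodes N). b D * a D + infsum (y D) V)) (states N)"
    by (simp add: states_def V_def case_prod_unfold)
  have nonneg: "0 \<le> (case x of (D, n) \<Rightarrow> b D * q n)" if "x \<in> states N" for x
    using that
    by (auto simp: b_def q_def states_def intro!: mult_nonneg_nonneg breakdown_dist_nonneg queue_dist_nonneg)
  have "L2_inner (stationary_measure N) f (QZ N g) = (\<Sum>D\<in>Pow (nodes N). b D * a D + infsum (y D) V)"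
  proof -
    have "integral\<^sup>L (stationary_measure N) (\<lambda>x. f x * QZ N g x)
        = (\<Sum>\<^sub>\<infinity>x\<in>states N. (case x of (D, n) \<Rightarrow> b D * q n) * (f x * QZ N g x))"
      unfolding stationary_measure_def
      by (rule integral_point_measure_eq_infsum(2)[OF nonneg _ has_sum_imp_summable[OF total]])
         (auto simp: b_def q_def)
    then show ?thesis using infsumI[OF total] by (simp add: L2_inner_def)
  qed
  also have "\<dots> = (\<Sum>D\<in>Pow (nodes N). infsum (y D) V) + (\<Sum>D\<in>Pow (nodes N). b D * a D)"
    by (simp add: sum.distrib)
  also have "(\<Sum>D\<in>Pow (nodes N). infsum (y D) V) = (\<Sum>\<^sub>\<infinity>n\<in>V. \<Sum>D\<in>Pow (nodes N). y D n)"
    using has_sum_finite_sum[where I="Pow (nodes N)" and F=y and s="\<lambda>D. infsum (y D) V" and A=V] y_sum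
    by (simp add: infsumI)
  also have "\<dots> = (\<Sum>\<^sub>\<infinity>n\<in>V. q n * (\<Sum>D\<in>Pow (nodes N). b D * f (D, n) * QY N (\<lambda>I. g (I, n)) D))"
    by (simp add: y_def sum_distrib_left)
  finally show ?thesis by (simp only: a_def b_def q_def V_def)
qed

end
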